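(* Let $\mathcal{D}[t]$ be a Fréchet space with conjugate dual $\mathcal{D}^\times$, let $(X,\mu)$ be a measure space with $\mu$ a $\sigma$-finite positive measure, and let $\omega: x\in X\mapsto\omega_x\in\mathcal{D}^\times$ be a total Riesz-Fischer distribution map. Then for every continuous seminorm $p$ on $\mathcal{D}$ there exists a constant $C>0$ such that, for every $h\in L^2(X,\mu)$ and the (unique) solution $f\in\mathcal{D}$ of the equation $\langle f|\omega_x\rangle=h(x)$ $\mu$-a.e., $$p(f)\le C\,\|\langle f|\omega_x\rangle\|_2 ,$$ where $\|\langle f|\omega_x\rangle\|_2$ is the $L^2(X,\mu)$-norm of the function $x\mapsto\langle f|\omega_x\rangle$.
   Context: For a locally convex space $\mathcal{D}[t]$, $\mathcal{D}^\times$ denotes the conjugate dual, i.e. the vector space of all continuous conjugate linear functionals on $\mathcal{D}[t]$. For $F\in\mathcal{D}^\times$ and $f\in\mathcal{D}$, $\langle F|f\rangle$ denotes the value of $F$ at $f$, and $\langle f|F\rangle:=\overline{\langle F|f\rangle}$ (which is linear in $f$). A map $\omega: X\to\mathcal{D}^\times$, $x\mapsto\omega_x$, is weakly measurable if for every $f\in\mathcal{D}$ the complex valued function $x\mapsto\langle f|\omega_x\rangle$ is $\mu$-measurable. A weakly measurable map $\omega$ is total if, whenever $f\in\mathcal{D}$ and $\langle f|\omega_x\rangle=0$ for $\mu$-a.e. $x\in X$, one has $f=0$. A weakly measurable map $\omega$ is a Riesz-Fischer distribution map (Riesz-Fischer map) if for every $h\in L^2(X,\mu)$ there exists $f\in\mathcal{D}$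 such that $\langle f|\omega_x\rangle=h(x)$ for $\mu$-a.e. $x\in X$; such an $f$ is called a solution of the equation $\langle f|\omega_x\rangle=h(x)$, and it is unique when $\omega$ is total. *)

theory Defs
  imports "HOL-Analysis.Analysis"
begin

text \<open>
  The library's real_vector and convex are tied to the real scalar multiplication of a type class
  and there is no class of complex vector spaces; the complex scalar multiplication is therefore
  an explicit parameter, governed by the library locale vector_space.
\<close>

definition convex_wrt :: "(complex \<Rightarrow> 'd::ab_group_add \<Rightarrow> 'd) \<Rightarrow> 'd set \<Rightarrow> bool" where
  "convex_wrt smul S \<longleftrightarrow>
     (\<forall>x\<in>S. \<forall>y\<in>S. \<forall>u::real. 0 \<le> u \<and> u \<le> 1 \<longrightarrow>
        smul (of_real u) x + smul (of_real (1 - u)) y \<in> S)"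

locale locally_convex_space = vector_space smul
  for smul :: "complex \<Rightarrow> 'd::topological_ab_group_add \<Rightarrow> 'd" +
  assumes continuous_scale: "continuous_on UNIV (\<lambda>(c, x). smul c x)"
    and locally_convex:
      "\<And>U. open U \<Longrightarrow> 0 \<in> U \<Longrightarrow> \<exists>V. open V \<and> 0 \<in> V \<and> V \<subseteq> U \<and> convex_wrt smul V"

text \<open>
  A Frechet space is a locally convex space whose topology is induced by some complete
  translation-invariant metric; in particular it is Hausdorff.
\<close>

locale frechet_space = locally_convex_space smul
  for smul :: "complex \<Rightarrow> 'd::topological_ab_group_add \<Rightarrow> 'd" +
  assumes complete_invariant_metric:
    "\<exists>d. Metric_space (UNIV :: 'd set) d
       \<and> (\<forall>x y z. d (x + z) (y + z) = d x y)
       \<and> Metric_space.mtopology UNIV d = euclidean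
       \<and> Metric_space.mcomplete UNIV d"

definition conjugate_dual ::
    "(complex \<Rightarrow> 'd::topological_ab_group_add \<Rightarrow> 'd) \<Rightarrow> ('d \<Rightarrow> complex) set" where
  "conjugate_dual smul =
     {F. (\<forall>f g. F (f + g) = F f + F g) \<and> (\<forall>c f. F (smul c f) = cnj c * F f) \<and>
         continuous_on UNIV F}"

text \<open>
  For \<open>F\<close> in the conjugate dual, \<open>\<langle>F|f\<rangle>\<close> is \<open>F f\<close>, and \<open>bracket f F\<close> is
  \<open>\<langle>f|F\<rangle>\<close>, its complex conjugate, which is linear in \<open>f\<close>.
\<close>

definition bracket :: "'d \<Rightarrow> ('d \<Rightarrow> complex) \<Rightarrow> complex" where
  "bracket f F = cnj (F f)"

definition weakly_measurable_map ::
    "(complex \<Rightarrow> 'd::topological_ab_group_add \<Rightarrow> 'd) \<Rightarrow> 'x measure \<Rightarrow> ('x \<Rightarrow> 'd \<Rightarrow> complex) \<Rightarrow> bool"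
  where
  "weakly_measurable_map smul M \<omega> \<longleftrightarrow>
     \<omega> \<in> space M \<rightarrow> conjugate_dual smul \<and>
     (\<forall>f. (\<lambda>x. bracket f (\<omega> x)) \<in> borel_measurable M)"

definition total_map ::
    "(complex \<Rightarrow> 'd::topological_ab_group_add \<Rightarrow> 'd) \<Rightarrow> 'x measure \<Rightarrow> ('x \<Rightarrow> 'd \<Rightarrow> complex) \<Rightarrow> bool"
  where
  "total_map smul M \<omega> \<longleftrightarrow>
     weakly_measurable_map smul M \<omega> \<and>
     (\<forall>f. (AE x in M. bracket f (\<omega> x) = 0) \<longrightarrow> f = 0)"

text \<open>
  Elements of \<open>L\<^sup>2\<close> are given by representatives: the statements below only involve
  functions up to almost everywhere equality.
\<close>

definition L2 :: "'x measure \<Rightarrow> ('x \<Rightarrow> complex) set" where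
  "L2 M = {h \<in> borel_measurable M. integrable M (\<lambda>x. (cmod (h x))\<^sup>2)}"

definition L2_norm :: "'x measure \<Rightarrow> ('x \<Rightarrow> complex) \<Rightarrow> real" where
  "L2_norm M h = sqrt (LINT x|M. (cmod (h x))\<^sup>2)"

definition is_solution ::
    "'x measure \<Rightarrow> ('x \<Rightarrow> 'd \<Rightarrow> complex) \<Rightarrow> ('x \<Rightarrow> complex) \<Rightarrow> 'd \<Rightarrow> bool" where
  "is_solution M \<omega> h f \<longleftrightarrow> (AE x in M. bracket f (\<omega> x) = h x)"

definition riesz_fischer_map ::
    "(complex \<Rightarrow> 'd::topological_ab_group_add \<Rightarrow> 'd) \<Rightarrow> 'x measure \<Rightarrow> ('x \<Rightarrow> 'd \<Rightarrow> complex) \<Rightarrow> bool"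
  where
  "riesz_fischer_map smul M \<omega> \<longleftrightarrow>
     weakly_measurable_map smul M \<omega> \<and> (\<forall>h\<in>L2 M. \<exists>f. is_solution M \<omega> h f)"

text \<open>Nonnegativity of a seminorm follows from the two conditions.\<close>

definition seminorm :: "(complex \<Rightarrow> 'd::ab_group_add \<Rightarrow> 'd) \<Rightarrow> ('d \<Rightarrow> real) \<Rightarrow> bool" where
  "seminorm smul p \<longleftrightarrow>
     (\<forall>f g. p (f + g) \<le> p f + p g) \<and> (\<forall>c f. p (smul c f) = cmod c * p f)"

end

theory Submission
  imports Defs
begin

text \<open>
  Totality makes \<open>N f = \<parallel>\<langle>f|\<omega>\<^sub>x\<rangle>\<parallel>\<^sub>2\<close> a norm on the space \<open>E\<close> of all \<open>f\<close> with
  \<open>\<langle>f|\<omega>\<^sub>x\<rangle>\<close> in \<open>L\<^sup>2\<close>, and the Riesz-Fischer property together with completeness of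
  \<open>L\<^sup>2\<close> makes \<open>(E, N)\<close> a Banach space, isometric to \<open>L\<^sup>2\<close>. The inclusion of \<open>E\<close>
  into \<open>\<D>\<close> has a closed graph: the partial sums of an absolutely convergent series
  in \<open>L\<^sup>2\<close> converge almost everywhere, while convergence in \<open>\<D>\<close> is carried to pointwise
  convergence by the continuous functionals \<open>\<omega>\<^sub>x\<close>. By the closed graph theorem, proved by
  Baire's theorem on \<open>(E, N)\<close>, the inclusion is continuous.
\<close>

subsection \<open>Square-integrable functions\<close>

lemma L2_norm_nonneg: "0 \<le> L2_norm M a"
  by (simp add: L2_norm_def)

lemma L2_norm_power2: "(L2_norm M a)\<^sup>2 = (LINT x|M. (cmod (a x))\<^sup>2)"
  by (simp add: L2_norm_def)

lemma L2_norm_scale: "L2_norm M (\<lambda>x. c * a x) = cmod c * L2_norm M a"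
  by (simp add: L2_norm_def norm_mult power_mult_distrib real_sqrt_mult)

lemma L2_zero: "(\<lambda>x. 0) \<in> L2 M"
  by (simp add: L2_def)

lemma L2_scale: "a \<in> L2 M \<Longrightarrow> (\<lambda>x. c * a x) \<in> L2 M"
  by (auto simp: L2_def norm_mult power_mult_distrib)

lemma L2_add:
  assumes a: "a \<in> L2 M" and b: "b \<in> L2 M"
  shows "(\<lambda>x. a x + b x) \<in> L2 M"
proof -
  have [measurable]: "a \<in> borel_measurable M" "b \<in> borel_measurable M"
    using a b by (auto simp: L2_def)
  have "integrable M (\<lambda>x. (cmod (a x + b x))\<^sup>2)"
  proof (rule Bochner_Integration.integrable_bound)
    show "integrable M (\<lambda>x. 2 * (cmod (a x))\<^sup>2 + 2 * (cmod (b x))\<^sup>2)"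
      using a b by (auto simp: L2_def)
    have "(cmod (a x + b x))\<^sup>2 \<le> 2 * (cmod (a x))\<^sup>2 + 2 * (cmod (b x))\<^sup>2" for x
    proof -
      have "(cmod (a x + b x))\<^sup>2 \<le> (cmod (a x) + cmod (b x))\<^sup>2"
        by (intro power_mono norm_triangle_ineq) auto
      also have "\<dots> \<le> 2 * (cmod (a x))\<^sup>2 + 2 * (cmod (b x))\<^sup>2"
        \<comment> \<open>The inequality is (|a| - |b|)^2 \<ge> 0 rearranged.\<close>
        using sum_squares_ge_zero[of "cmod (a x) - cmod (b x)" 0]
        by (simp add: power2_eq_square algebra_simps)
      finally show ?thesis .
    qed
    then show "AE x in M. norm ((cmod (a x + b x))\<^sup>2)
        \<le> norm (2 * (cmod (a x))\<^sup>2 + 2 * (cmod (b x))\<^sup>2)"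
      by auto
  qed measurable
  then show ?thesis
    by (simp add: L2_def)
qed

lemma L2_norm_eq_0:
  assumes "a \<in> L2 M" and "L2_norm M a = 0"
  shows "AE x in M. a x = 0"
proof -
  have "(LINT x|M. (cmod (a x))\<^sup>2) = 0"
    using assms(2) L2_norm_power2[of M a] by simp
  then have "AE x in M. (cmod (a x))\<^sup>2 = 0"
    using assms(1) by (subst (asm) integral_nonneg_eq_0_iff_AE) (auto simp: L2_def)
  then show ?thesis
    by simp
qed

lemma L2_cong_AE:
  assumes "h \<in> L2 M" "a \<in> borel_measurable M" "AE x in M. a x = h x"
  shows "a \<in> L2 M"
proof -
  have [measurable]: "a \<in> borel_measurable M" "h \<in> borel_measurable M"
    using assms by (auto simp: L2_def)
  have "integrable M (\<lambda>x. (cmod (a x))\<^sup>2) \<longleftrightarrow> integrable M (\<lambda>x. (cmod (h x))\<^sup>2)"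
    by (rule integrable_cong_AE) (use assms(3) in auto)
  then show ?thesis
    using assms(1) by (simp add: L2_def)
qed

lemma L2_norm_cong_AE:
  assumes "a \<in> borel_measurable M" "b \<in> borel_measurable M" "AE x in M. a x = b x"
  shows "L2_norm M a = L2_norm M b"
proof -
  have [measurable]: "a \<in> borel_measurable M" "b \<in> borel_measurable M"
    using assms by auto
  have "(LINT x|M. (cmod (a x))\<^sup>2) = (LINT x|M. (cmod (b x))\<^sup>2)"
    by (rule integral_cong_AE) (use assms(3) in auto)
  then show ?thesis
    by (simp add: L2_norm_def)
qed

text \<open>
  With \<open>A = \<parallel>a\<parallel>\<close> and \<open>B = \<parallel>b\<parallel>\<close>, convexity of the square gives
  \<open>|a + b|\<^sup>2 \<le> (A + B) (|a|\<^sup>2 / A + |b|\<^sup>2 / B)\<close> pointwise, and the right-hand side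
  integrates to \<open>(A + B)\<^sup>2\<close>.
\<close>
lemma L2_norm_triangle:
  assumes a: "a \<in> L2 M" and b: "b \<in> L2 M"
  shows "L2_norm M (\<lambda>x. a x + b x) \<le> L2_norm M a + L2_norm M b"
proof -
  define A B where "A = L2_norm M a" and "B = L2_norm M b"
  have [measurable]: "a \<in> borel_measurable M" "b \<in> borel_measurable M"
    using a b by (auto simp: L2_def)
  \<comment> \<open>The weights of the convexity argument divide by \<open>A\<close> and
    \<open>B\<close>, so a vanishing norm is treated apart, where that function is zero almost
    everywhere.\<close>
  consider "A = 0" | "B = 0" | "A > 0" "B > 0"
    using L2_norm_nonneg[of M a] L2_norm_nonneg[of M b] by (force simp: A_def B_def)
  then show ?thesis
  proof cases
    case 1
    then have "AE x in M. a x + b x = b x"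
      using L2_norm_eq_0[OF a] by (auto simp: A_def)
    then have "L2_norm M (\<lambda>x. a x + b x) = B"
      unfolding B_def by (intro L2_norm_cong_AE) auto
    then show ?thesis
      using 1 by (simp add: A_def B_def)
  next
    case 2
    then have "AE x in M. a x + b x = a x"
      using L2_norm_eq_0[OF b] by (auto simp: B_def)
    then have "L2_norm M (\<lambda>x. a x + b x) = A"
      unfolding A_def by (intro L2_norm_cong_AE) auto
    then show ?thesis
      using 2 by (simp add: A_def B_def)
  next
    case 3
    have le: "(cmod (a x + b x))\<^sup>2
        \<le> (1 + B / A) * (cmod (a x))\<^sup>2 + (1 + A / B) * (cmod (b x))\<^sup>2" for x
    proof -
      define s t where "s = cmod (a x)" and "t = cmod (b x)"
      have "(cmod (a x + b x))\<^sup>2 \<le> (s + t)\<^sup>2"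
        unfolding s_def t_def by (intro power_mono norm_triangle_ineq) auto
      \<comment> \<open>The defect in the convexity inequality is an explicit square, which vanishes
        exactly when s / A = t / B.\<close>
      moreover have "(s + t)\<^sup>2 + (B * s - A * t)\<^sup>2 / (A * B)
          = (1 + B / A) * s\<^sup>2 + (1 + A / B) * t\<^sup>2"
        using 3 by (simp add: field_simps power2_eq_square)
      moreover have "0 \<le> (B * s - A * t)\<^sup>2 / (A * B)"
        using 3 by simp
      ultimately show ?thesis
        unfolding s_def t_def by linarith
    qed
    have "(L2_norm M (\<lambda>x. a x + b x))\<^sup>2
        \<le> (LINT x|M. (1 + B / A) * (cmod (a x))\<^sup>2 + (1 + A / B) * (cmod (b x))\<^sup>2)"
      unfolding L2_norm_power2
      using a b L2_add[OF a b] le by (intro integral_mono) (auto simp: L2_def)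
    also have "\<dots> = (1 + B / A) * A\<^sup>2 + (1 + A / B) * B\<^sup>2"
      using a b by (simp add: A_def B_def L2_norm_power2 L2_def)
    also have "\<dots> = (A + B)\<^sup>2"
      using 3 by (simp add: field_simps power2_eq_square)
    finally show ?thesis
      unfolding A_def[symmetric] B_def[symmetric] by (rule power2_le_imp_le) (use 3 in simp)
  qed
qed

lemma L2_norm_zero: "L2_norm M (\<lambda>x. 0) = 0"
  by (simp add: L2_norm_def)

text \<open>Membership and bound are proved together, since the triangle inequality in the induction
  step requires the smaller sum to be in \<open>L2 M\<close>.\<close>

lemma L2_sum:
  assumes "\<And>k. k \<in> I \<Longrightarrow> u k \<in> L2 M"
  shows "(\<lambda>x. \<Sum>k\<in>I. u k x) \<in> L2 M \<and>
    L2_norm M (\<lambda>x. \<Sum>k\<in>I. u k x) \<le> (\<Sum>k\<in>I. L2_norm M (u k))"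
  using assms
proof (induction I rule: infinite_finite_induct)
  case (insert i I)
  then have IH: "(\<lambda>x. \<Sum>k\<in>I. u k x) \<in> L2 M"
      "L2_norm M (\<lambda>x. \<Sum>k\<in>I. u k x) \<le> (\<Sum>k\<in>I. L2_norm M (u k))" "u i \<in> L2 M"
    by auto
  show ?case
    using insert.hyps L2_add[OF IH(3,1)] L2_norm_triangle[OF IH(3,1)] IH(2) by simp
qed (auto simp: L2_zero L2_norm_zero)

text \<open>
  The squares of the partial sums of \<open>\<Sum>|u\<^sub>k|\<close> have integrals bounded by
  \<open>(\<Sum>\<parallel>u\<^sub>k\<parallel>)\<^sup>2\<close>, so by monotone convergence their supremum is an integrable majorant.
\<close>
lemma L2_series:
  fixes u :: "nat \<Rightarrow> 'x \<Rightarrow> complex"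
  assumes u: "\<And>k. u k \<in> L2 M" and sum: "summable (\<lambda>k. L2_norm M (u k))"
  obtains h where "h \<in> L2 M"
    and "AE x in M. (\<lambda>n. \<Sum>k<n. u k x) \<longlonglongrightarrow> h x"
    and "(\<lambda>n. L2_norm M (\<lambda>x. h x - (\<Sum>k<n. u k x))) \<longlonglongrightarrow> 0"
proof -
  define S where "S = (\<Sum>k. L2_norm M (u k))"
  define P where "P n x = (\<Sum>k<n. cmod (u k x))\<^sup>2" for n x
  define Q where "Q x = (SUP n. ennreal (P n x))" for x
  \<comment> \<open>Where the series diverges the value of \<open>h\<close> is arbitrary; this can
    happen only where \<open>Q\<close> is infinite, which turns out to be a null set.\<close>
  define h where "h x = (\<Sum>k. u k x)" for x
  have [measurable]: "u k \<in> borel_measurable M" for k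
    using u by (auto simp: L2_def)
  have [measurable]: "P n \<in> borel_measurable M" for n
    unfolding P_def by measurable
  have [measurable]: "Q \<in> borel_measurable M"
    unfolding Q_def by measurable
  have [measurable]: "h \<in> borel_measurable M"
    unfolding h_def by measurable
  have int_P: "(\<integral>\<^sup>+x. ennreal (P n x) \<partial>M) \<le> ennreal (S\<^sup>2)" for n
  proof -
    \<comment> \<open>\<open>L2 M\<close> consists of complex functions, so the moduli are embedded
      into the complex numbers before \<open>L2_sum\<close> is applied.\<close>
    have v: "(\<lambda>x. of_real (cmod (u k x))) \<in> L2 M" for k
      using u[of k] by (auto simp: L2_def)
    have "L2_norm M (\<lambda>x. of_real (cmod (u k x))) = L2_norm M (u k)" for k
      by (simp add: L2_norm_def)
    with L2_sum[of "{..<n}" "\<lambda>k x. of_real (cmod (u k x))" M] v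
    have *: "(\<lambda>x. \<Sum>k<n. of_real (cmod (u k x)) :: complex) \<in> L2 M"
        "L2_norm M (\<lambda>x. \<Sum>k<n. of_real (cmod (u k x))) \<le> (\<Sum>k<n. L2_norm M (u k))"
      by simp_all
    have P_eq: "P n x = (cmod (\<Sum>k<n. of_real (cmod (u k x))))\<^sup>2" for x
      unfolding of_real_sum[symmetric] norm_of_real by (simp add: P_def)
    have "(\<Sum>k<n. L2_norm M (u k)) \<le> S"
      unfolding S_def using sum by (intro sum_le_suminf) (auto simp: L2_norm_nonneg)
    then have "(L2_norm M (\<lambda>x. \<Sum>k<n. of_real (cmod (u k x))))\<^sup>2 \<le> S\<^sup>2"
      using *(2) by (intro power_mono) (auto simp: L2_norm_nonneg)
    then have "(LINT x|M. P n x) \<le> S\<^sup>2"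
      unfolding L2_norm_power2 P_eq .
    moreover have "integrable M (P n)"
      using *(1) unfolding L2_def P_eq[abs_def] by blast
    then have "(\<integral>\<^sup>+x. ennreal (P n x) \<partial>M) = ennreal (LINT x|M. P n x)"
      by (rule nn_integral_eq_integral) (simp add: P_def)
    ultimately show ?thesis
      by (simp add: ennreal_leI)
  qed
  have P_mono: "P m x \<le> P n x" if "m \<le> n" for m n x
    unfolding P_def using that by (intro power_mono sum_mono2) (auto intro: sum_nonneg)
  have "(\<integral>\<^sup>+x. Q x \<partial>M) = (SUP n. \<integral>\<^sup>+x. ennreal (P n x) \<partial>M)"
    unfolding Q_def
    by (rule nn_integral_monotone_convergence_SUP)
      (auto simp: incseq_def le_fun_def intro!: ennreal_leI P_mono)
  also have "\<dots> \<le> ennreal (S\<^sup>2)"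
    by (rule SUP_least) (rule int_P)
  finally have Q_fin: "(\<integral>\<^sup>+x. Q x \<partial>M) < top"
    by (rule le_less_trans) simp
  then have Q_AE: "AE x in M. Q x < top"
    using nn_integral_PInf_AE[of Q M] by (auto simp: less_top)
  \<comment> \<open>\<open>enn2real\<close> sends \<open>top\<close> to 0, so \<open>w\<close> is a
    real majorant that differs from \<open>Q\<close> only on a null set.\<close>
  define w where "w x = enn2real (Q x)" for x
  have w: "integrable M w"
  proof (rule integrableI_bounded)
    show "w \<in> borel_measurable M"
      unfolding w_def by measurable
    have "(\<integral>\<^sup>+x. ennreal (norm (w x)) \<partial>M) = (\<integral>\<^sup>+x. Q x \<partial>M)"
      using Q_AE by (intro nn_integral_cong_AE) (auto simp: w_def)
    then show "(\<integral>\<^sup>+x. ennreal (norm (w x)) \<partial>M) < \<infinity>"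
      using Q_fin by simp
  qed
  have P_le: "P n x \<le> w x" if "Q x < top" for n x
  proof -
    have "ennreal (P n x) \<le> Q x"
      unfolding Q_def by (rule SUP_upper) simp
    also have "Q x = ennreal (w x)"
      using that by (simp add: w_def)
    finally show ?thesis
      by (simp add: w_def)
  qed
  have lim: "(\<lambda>n. \<Sum>k<n. u k x) \<longlonglongrightarrow> h x" if "Q x < top" for x
  proof -
    have "(\<Sum>k<n. cmod (u k x)) \<le> sqrt (w x)" for n
      using P_le[OF that, of n] by (simp add: P_def real_le_rsqrt)
    then have "summable (\<lambda>k. cmod (u k x))"
      by (intro summableI_nonneg_bounded) auto
    then show ?thesis
      unfolding h_def by (rule summable_LIMSEQ[OF summable_norm_cancel])
  qed
  \<comment> \<open>The estimate is the limit m \<rightarrow> \<infinity> of the same estimate for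
    the m-th partial sum in place of \<open>h\<close>, which \<open>P m x\<close> controls.\<close>
  have bound: "(cmod (h x - (\<Sum>k<n. u k x)))\<^sup>2 \<le> w x" if "Q x < top" for n x
  proof (rule LIMSEQ_le_const2)
    show "(\<lambda>m. (cmod ((\<Sum>k<m. u k x) - (\<Sum>k<n. u k x)))\<^sup>2)
        \<longlonglongrightarrow> (cmod (h x - (\<Sum>k<n. u k x)))\<^sup>2"
      by (intro tendsto_intros lim that)
    have "(cmod ((\<Sum>k<m. u k x) - (\<Sum>k<n. u k x)))\<^sup>2 \<le> w x" if "n \<le> m" for m
    proof -
      have "(\<Sum>k<m. u k x) - (\<Sum>k<n. u k x) = (\<Sum>k\<in>{n..<m}. u k x)"
        using sum_diff_nat_ivl[of 0 n m "\<lambda>k. u k x"] that by (simp add: atLeast0LessThan)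
      also have "cmod \<dots> \<le> (\<Sum>k\<in>{n..<m}. cmod (u k x))"
        by (rule norm_sum)
      also have "\<dots> \<le> (\<Sum>k<m. cmod (u k x))"
        by (rule sum_mono2) auto
      finally have "(cmod ((\<Sum>k<m. u k x) - (\<Sum>k<n. u k x)))\<^sup>2 \<le> P m x"
        unfolding P_def by (intro power_mono) auto
      then show ?thesis
        using P_le[OF \<open>Q x < top\<close>, of m] by simp
    qed
    then show "\<exists>N. \<forall>m\<ge>N. (cmod ((\<Sum>k<m. u k x) - (\<Sum>k<n. u k x)))\<^sup>2 \<le> w x"
      by blast
  qed
  show thesis
  proof
    have "AE x in M. norm ((cmod (h x))\<^sup>2) \<le> norm (w x)"
      using Q_AE
    proof eventually_elim
      case (elim x)
      \<comment> \<open>The empty partial sum, \<open>n = 0\<close>, turns \<open>bound\<close> into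
        |h|^2 \<le> w.\<close>
      show ?case
        using bound[OF elim, of 0] by (simp add: w_def)
    qed
    then have "integrable M (\<lambda>x. (cmod (h x))\<^sup>2)"
      by (intro Bochner_Integration.integrable_bound[OF w]) auto
    then show "h \<in> L2 M"
      by (simp add: L2_def)
    show "AE x in M. (\<lambda>n. \<Sum>k<n. u k x) \<longlonglongrightarrow> h x"
      using Q_AE lim by auto
    have "(\<lambda>n. LINT x|M. (cmod (h x - (\<Sum>k<n. u k x)))\<^sup>2) \<longlonglongrightarrow> (LINT x|M. 0)"
    proof (rule integral_dominated_convergence[where w = w])
      show "AE x in M. (\<lambda>n. (cmod (h x - (\<Sum>k<n. u k x)))\<^sup>2) \<longlonglongrightarrow> 0"
        using Q_AE
      proof eventually_elim
        case (elim x)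
        have "(\<lambda>n. (cmod (h x - (\<Sum>k<n. u k x)))\<^sup>2) \<longlonglongrightarrow> (cmod (h x - h x))\<^sup>2"
          by (intro tendsto_intros lim elim)
        then show ?case
          by simp
      qed
      show "AE x in M. norm ((cmod (h x - (\<Sum>k<n. u k x)))\<^sup>2) \<le> w x" for n
        using Q_AE bound by auto
    qed (auto simp: w)
    then show "(\<lambda>n. L2_norm M (\<lambda>x. h x - (\<Sum>k<n. u k x))) \<longlonglongrightarrow> 0"
      unfolding L2_norm_def using tendsto_real_sqrt by fastforce
  qed
qed

subsection \<open>The closed graph theorem\<close>

text \<open>Completeness is stated through absolutely convergent series because
  \<open>L2_series\<close> delivers it in that form. Subadditivity and definiteness are restricted
  to \<open>E\<close>: in the application \<open>N\<close> takes the default value 0 of the integral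
  outside \<open>E\<close>.\<close>

locale complete_norm_on = vector_space smul
  for smul :: "complex \<Rightarrow> 'd::ab_group_add \<Rightarrow> 'd" +
  fixes E :: "'d set" and N :: "'d \<Rightarrow> real"
  assumes subspace_E: "subspace E"
    and N_nonneg: "0 \<le> N f"
    and N_scale: "N (smul c f) = cmod c * N f"
    and N_add: "f \<in> E \<Longrightarrow> g \<in> E \<Longrightarrow> N (f + g) \<le> N f + N g"
    and N_eq_0: "f \<in> E \<Longrightarrow> N f = 0 \<Longrightarrow> f = 0"
    and N_series: "(\<And>k. u k \<in> E) \<Longrightarrow> summable (\<lambda>k. N (u k)) \<Longrightarrow>
      \<exists>f\<in>E. (\<lambda>n. N (f - (\<Sum>k<n. u k))) \<longlonglongrightarrow> 0"
begin

lemma N_minus: "N (- f) = N f"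
  using N_scale[of "-1" f] by (simp add: scale_minus_left)

lemma N_minus_commute: "N (f - g) = N (g - f)"
  using N_minus[of "f - g"] by simp

lemma N_zero: "N 0 = 0"
  using N_scale[of 0 0] by simp

lemma N_diff: "f \<in> E \<Longrightarrow> g \<in> E \<Longrightarrow> N (f - g) \<le> N f + N g"
  using N_add[of f "- g"] by (simp add: N_minus subspace_neg[OF subspace_E])

sublocale norm: Metric_space E "\<lambda>f g. N (f - g)"
proof
  show "0 \<le> N (f - g)" for f g
    by (rule N_nonneg)
  show "N (f - g) = N (g - f)" for f g
    by (rule N_minus_commute)
  show "N (f - g) = 0 \<longleftrightarrow> f = g" if "f \<in> E" "g \<in> E" for f g
    using N_eq_0[OF subspace_diff[OF subspace_E that]] by (auto simp: N_zero)
  show "N (f - h) \<le> N (f - g) + N (g - h)" if "f \<in> E" "g \<in> E" "h \<in> E" for f g h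
    using N_add[of "f - g" "g - h"] that by (simp add: subspace_diff[OF subspace_E])
qed

text \<open>A Cauchy sequence has a subsequence with consecutive distances at most (1/2)^n. Its
  increments form an absolutely convergent series, and a Cauchy sequence with a convergent
  subsequence converges.\<close>

lemma mcomplete_norm: "norm.mcomplete"
  unfolding norm.mcomplete_def
proof (intro allI impI)
  fix \<sigma> assume \<sigma>: "norm.MCauchy \<sigma>"
  then have in_E: "\<sigma> n \<in> E" for n
    by (auto simp: norm.MCauchy_def)
  define P where "P n x \<longleftrightarrow> (\<forall>m\<ge>x. \<forall>m'\<ge>x. N (\<sigma> m - \<sigma> m') < (1/2) ^ n)" for n x :: nat
  have P: "\<exists>x. P n x" for n
    using \<sigma> by (auto simp: norm.MCauchy_def P_def)
  have "\<exists>r. \<forall>n. P n (r n) \<and> r n < r (Suc n)"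
  proof (rule dependent_nat_choice)
    show "\<exists>x. P 0 x"
      by (rule P)
    fix x n
    obtain y where "P (Suc n) y"
      using P by blast
    \<comment> \<open>\<open>P n\<close> is inherited by larger indices, so the maximum can be taken
      to make \<open>r\<close> strictly increasing.\<close>
    then have "P (Suc n) (max y (Suc x))"
      by (auto simp: P_def)
    then show "\<exists>y. P (Suc n) y \<and> x < y"
      by (intro exI[of _ "max y (Suc x)"]) auto
  qed
  then obtain r where r: "\<And>n. P n (r n)" "\<And>n. r n < r (Suc n)"
    by blast
  then have mono: "strict_mono r"
    by (simp add: strict_mono_Suc_iff)
  define u where "u n = \<sigma> (r (Suc n)) - \<sigma> (r n)" for n
  have u: "u n \<in> E" for n
    unfolding u_def by (rule subspace_diff[OF subspace_E in_E in_E])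
  have "N (u n) \<le> (1/2) ^ n" for n
    using r(1)[of n] r(2)[of n] unfolding P_def u_def by (meson less_imp_le order_refl)
  then have "summable (\<lambda>n. N (u n))"
    by (intro summable_comparison_test'[OF summable_geometric[of "1/2 :: real"], of 0])
      (auto simp: N_nonneg)
  with u obtain f where f: "f \<in> E" "(\<lambda>n. N (f - (\<Sum>k<n. u k))) \<longlonglongrightarrow> 0"
    using N_series by blast
  have sum_u: "(\<Sum>k<n. u k) = \<sigma> (r n) - \<sigma> (r 0)" for n
    unfolding u_def by (rule sum_lessThan_telescope)
  have "(\<lambda>n. N (\<sigma> (r n) - (f + \<sigma> (r 0)))) \<longlonglongrightarrow> 0"
    using f(2) unfolding sum_u by (subst N_minus_commute) (simp add: algebra_simps)
  then have "limitin norm.mtopology (\<sigma> \<circ> r) (f + \<sigma> (r 0)) sequentially"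
    by (simp add: norm.limitin_metric_dist_null in_E subspace_add[OF subspace_E f(1)])
  then show "\<exists>x. limitin norm.mtopology \<sigma> x sequentially"
    using norm.MCauchy_convergent_subsequence[OF \<sigma> mono] by blast
qed

text \<open>The closures of the sets E \<inter> (k+1)V cover \<open>E\<close>, so by Baire one of
  them contains a ball around some \<open>f0\<close>. Subtracting approximations of
  \<open>f0 + G\<close> and \<open>f0\<close> approximates \<open>G\<close>, whence the difference
  \<open>a - b\<close>.\<close>

lemma absorbing_imp_nearly_open:
  assumes absorb: "\<And>f. f \<in> E \<Longrightarrow> \<exists>k::nat. smul (1 / of_nat (Suc k)) f \<in> V"
  obtains r where "r > 0"
    and "\<And>g \<epsilon>. g \<in> E \<Longrightarrow> N g < r \<Longrightarrow> 0 < \<epsilon> \<Longrightarrow>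
      \<exists>a\<in>E \<inter> V. \<exists>b\<in>E \<inter> V. N (g - (a - b)) < \<epsilon>"
proof -
  define A where "A k = {f \<in> E. smul (1 / of_nat (Suc k)) f \<in> V}" for k
  define C where "C k = norm.mtopology closure_of A k" for k
  have C_mem: "f \<in> C k \<longleftrightarrow> f \<in> E \<and> (\<forall>\<epsilon>>0. \<exists>a\<in>A k. N (f - a) < \<epsilon>)" for f k
    unfolding C_def norm.metric_closure_of by (auto simp: A_def)
  have zero: "0 \<in> E"
    by (rule subspace_0[OF subspace_E])
  have "E \<subseteq> \<Union>(range C)"
  proof
    fix f assume f: "f \<in> E"
    then obtain k where "f \<in> A k"
      using absorb by (auto simp: A_def)
    then have "f \<in> C k"
      unfolding C_mem using f by (auto intro!: bexI[of _ f] simp: N_zero)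
    then show "f \<in> \<Union>(range C)"
      by blast
  qed
  then have "0 \<in> norm.mtopology interior_of \<Union>(range C)"
    unfolding norm.in_interior_of_mball using zero norm.mball_subset_mspace
    by (metis order_trans zero_less_one)
  moreover have "closedin norm.mtopology (C k)" for k
    by (simp add: C_def)
  ultimately obtain k where "norm.mtopology interior_of C k \<noteq> {}"
    using norm.metric_Baire_category_alt[OF mcomplete_norm, of "range C"] by blast
  then obtain f0 r where f0: "f0 \<in> E" "r > 0" "norm.mball f0 r \<subseteq> C k"
    by (metis ex_in_conv norm.in_interior_of_mball)
  define n where "n = real (Suc k)"
  have n: "n > 0"
    by (simp add: n_def)
  show thesis
  proof
    show "r / n > 0"
      using f0(2) n by simp
    fix g \<epsilon> assume g: "g \<in> E" "N g < r / n" and \<epsilon>: "0 < (\<epsilon>::real)"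
    \<comment> \<open>Multiplying by n = k + 1 brings the problem to the scale of
      \<open>A k\<close>; the map \<open>s\<close> below scales back and sends \<open>A k\<close>
      into \<open>V\<close>.\<close>
    define G where "G = smul (of_real n) g"
    have G: "G \<in> E" "N G < r"
      using g n by (auto simp: G_def subspace_scale[OF subspace_E] N_scale field_simps)
    have "f0 + G \<in> C k" "f0 \<in> C k"
      using f0 G by (auto intro!: subsetD[OF f0(3)]
        simp: N_minus N_zero subspace_add[OF subspace_E])
    moreover have "n * \<epsilon> / 2 > 0"
      using n \<epsilon> by simp
    ultimately obtain a b where a: "a \<in> A k" "N (f0 + G - a) < n * \<epsilon> / 2"
      and b: "b \<in> A k" "N (f0 - b) < n * \<epsilon> / 2"
      unfolding C_mem by blast
    have ab: "a \<in> E" "b \<in> E"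
      using a b by (auto simp: A_def)
    define s where "s = smul (1 / of_real n)"
    have s: "s a \<in> E \<inter> V" "s b \<in> E \<inter> V"
      using a b by (auto simp: s_def A_def n_def subspace_scale[OF subspace_E])
    have "g = s G"
      using n by (simp add: G_def s_def)
    then have "g - (s a - s b) = s ((f0 + G - a) - (f0 - b))"
      by (simp add: s_def scale_right_diff_distrib scale_right_distrib)
    then have "N (g - (s a - s b)) = N ((f0 + G - a) - (f0 - b)) / n"
      using n by (simp add: s_def N_scale norm_divide)
    also have "\<dots> \<le> (N (f0 + G - a) + N (f0 - b)) / n"
      using n ab f0(1) G(1)
      by (intro divide_right_mono N_diff)
        (auto simp: subspace_add[OF subspace_E] subspace_diff[OF subspace_E])
    also have "\<dots> < \<epsilon>"
      using a(2) b(2) n by (simp add: field_simps)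
    finally show "\<exists>a\<in>E \<inter> V. \<exists>b\<in>E \<inter> V. N (g - (a - b)) < \<epsilon>"
      using s by blast
  qed
qed

end

text \<open>This makes every neighbourhood of 0 absorbing, as the Baire argument requires.\<close>

lemma (in locally_convex_space) scale_tendsto_0:
  "(\<lambda>k. smul (1 / of_nat (Suc k)) f) \<longlonglongrightarrow> 0"
proof -
  have "(\<lambda>k. 1 / of_nat (Suc k) :: complex) \<longlonglongrightarrow> 0"
    using LIMSEQ_Suc[OF lim_1_over_n] by simp
  then have "(\<lambda>k. (1 / of_nat (Suc k) :: complex, f)) \<longlonglongrightarrow> (0, f)"
    by (intro tendsto_intros)
  from continuous_on_tendsto_compose[OF continuous_scale this] show ?thesis
    by simp
qed

lemma seminorm_zero:
  assumes "vector_space smul" "seminorm smul p"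
  shows "p 0 = 0"
proof -
  interpret vector_space smul by fact
  have "p (smul 0 0) = cmod 0 * p 0"
    using assms(2) unfolding seminorm_def by blast
  then show ?thesis
    by simp
qed

text \<open>
  The closed graph theorem for the inclusion of \<open>(E, N)\<close> into the Frechet space; only the
  closedness along partial sums of \<open>N\<close>-absolutely convergent series is required.
\<close>
lemma closed_graph_seminorm_bound:
  fixes smul :: "complex \<Rightarrow> 'd::topological_ab_group_add \<Rightarrow> 'd"
  assumes "frechet_space smul" and "complete_norm_on smul E N"
    and closed: "\<And>u f g. (\<And>k. u k \<in> E) \<Longrightarrow> summable (\<lambda>k. N (u k)) \<Longrightarrow> f \<in> E \<Longrightarrow>
      (\<lambda>n. N (f - (\<Sum>k<n. u k))) \<longlonglongrightarrow> 0 \<Longrightarrow> (\<lambda>n. \<Sum>k<n. u k) \<longlonglongrightarrow> g \<Longrightarrow> f = g"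
    and p: "seminorm smul p" "continuous_on UNIV p"
  shows "\<exists>C>0. \<forall>f\<in>E. p f \<le> C * N f"
proof -
  interpret frechet_space smul by fact
  interpret complete_norm_on smul E N by fact
  obtain d where d: "Metric_space (UNIV :: 'd set) d" "\<And>x y z. d (x + z) (y + z) = d x y"
    and d_top: "Metric_space.mtopology UNIV d = euclidean"
    and d_complete: "Metric_space.mcomplete UNIV d"
    using complete_invariant_metric by blast
  interpret metr: Metric_space "UNIV :: 'd set" d by (rule d(1))
  \<comment> \<open>By invariance \<open>d\<close> is determined by the subadditive function
    \<open>q\<close>, which need not be homogeneous.\<close>
  define q where "q x = d x 0" for x
  have d_eq: "d x y = q (x - y)" for x y
    using d(2)[of "x - y" y 0] by (simp add: q_def)
  have q_diff: "q (x - y) \<le> q x + q y" for x y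
    unfolding d_eq[symmetric] using metr.triangle[of x 0 y] metr.commute[of 0 y]
    by (simp add: q_def)
  have q_triangle: "q (x - z) \<le> q (x - y) + q (y - z)" for x y z
    using metr.triangle[of x y z] by (simp add: d_eq)
  have tendsto_q: "f \<longlonglongrightarrow> l \<longleftrightarrow> (\<lambda>n. q (f n - l)) \<longlonglongrightarrow> 0" for f l
    using metr.limitin_metric_dist_null[of f l sequentially] by (simp add: d_top d_eq)
  have "\<exists>r>0. \<forall>g\<in>E. N g < r \<longrightarrow> (\<forall>\<epsilon>>0. \<exists>u\<in>E. q u < (1/2) ^ n \<and> N (g - u) < \<epsilon>)" for n
  proof -
    \<comment> \<open>The radius is halved because the approximants are differences of two elements
      of \<open>V\<close>.\<close>
    define V where "V = {f. q f < (1/2) ^ Suc n}"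
    have "\<exists>k::nat. smul (1 / of_nat (Suc k)) f \<in> V" for f
    proof -
      have "(\<lambda>k. q (smul (1 / of_nat (Suc k)) f)) \<longlonglongrightarrow> 0"
        using scale_tendsto_0[of f] unfolding tendsto_q by simp
      then have "\<forall>\<^sub>F k in sequentially. q (smul (1 / of_nat (Suc k)) f) < (1/2) ^ Suc n"
        by (rule order_tendstoD) simp
      then show ?thesis
        unfolding V_def eventually_sequentially by blast
    qed
    then obtain r where r: "r > 0" "\<And>g \<epsilon>. g \<in> E \<Longrightarrow> N g < r \<Longrightarrow> 0 < \<epsilon> \<Longrightarrow>
        \<exists>a\<in>E \<inter> V. \<exists>b\<in>E \<inter> V. N (g - (a - b)) < \<epsilon>"
      using absorbing_imp_nearly_open[of V] by blast
    have diff_V: "q (a - b) < (1/2) ^ n" if "a \<in> V" "b \<in> V" for a b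
      using q_diff[of a b] that by (simp add: V_def)
    have "\<exists>u\<in>E. q u < (1/2) ^ n \<and> N (g - u) < \<epsilon>" if "g \<in> E" "N g < r" "0 < \<epsilon>" for g \<epsilon>
      using r(2)[OF that] diff_V subspace_diff[OF subspace_E] by blast
    then show ?thesis
      using r(1) by blast
  qed
  then obtain r where r: "\<And>n. r n > 0" "\<And>n g \<epsilon>. g \<in> E \<Longrightarrow> N g < r n \<Longrightarrow> 0 < \<epsilon> \<Longrightarrow>
      \<exists>u\<in>E. q u < (1/2) ^ n \<and> N (g - u) < \<epsilon>"
    by metis
  \<comment> \<open>The bound by \<open>r n\<close> permits the next approximation; the bound by
    (1/2)^n makes the remainders, and hence the series, small in \<open>N\<close>.\<close>
  define s where "s n = min (r n) ((1/2) ^ n)" for n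
  have s: "s n > 0" "s n \<le> r n" "s n \<le> (1/2) ^ n" for n
    using r(1)[of n] by (auto simp: s_def)
  \<comment> \<open>Successive approximation: \<open>R k\<close> is the remainder after k steps, and
    each step is small for \<open>q\<close>. The sums \<open>f - R m\<close> tend to
    \<open>f\<close> for \<open>N\<close> and, by completeness, to some \<open>g\<close> in the
    Frechet space. Closedness gives \<open>f = g\<close>, and the geometric series bounds
    \<open>q g\<close>.\<close>
  have small: "q f \<le> 2 * (1/2) ^ n" if f: "f \<in> E" "N f < s n" for f n
  proof -
    define P where "P k x \<longleftrightarrow> x \<in> E \<and> N x < s (n + k) \<and> (k = 0 \<longrightarrow> x = f)" for k x
    have "\<exists>R. \<forall>k. P k (R k) \<and> q (R k - R (Suc k)) < (1/2) ^ (n + k)"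
    proof (rule dependent_nat_choice)
      show "\<exists>x. P 0 x"
        using f by (auto simp: P_def)
      fix x k assume "P k x"
      then have x: "x \<in> E" "N x < r (n + k)"
        using s(2)[of "n + k"] by (auto simp: P_def)
      then obtain u where "u \<in> E" "q u < (1/2) ^ (n + k)" "N (x - u) < s (n + Suc k)"
        using r(2)[OF x s(1)] by blast
      then show "\<exists>y. P (Suc k) y \<and> q (x - y) < (1/2) ^ (n + k)"
        by (intro exI[of _ "x - u"]) (auto simp: P_def x subspace_diff[OF subspace_E])
    qed
    then obtain R where PR: "\<And>k. P k (R k)"
      and qR: "\<And>k. q (R k - R (Suc k)) < (1/2) ^ (n + k)"
      by blast
    have R: "R k \<in> E" "N (R k) < s (n + k)" "R 0 = f" for k
      using PR[of k] PR[of 0] by (auto simp: P_def)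
    define u where "u k = R k - R (Suc k)" for k
    have u: "u k \<in> E" for k
      unfolding u_def by (rule subspace_diff[OF subspace_E R(1) R(1)])
    have sum_u: "(\<Sum>k<m. u k) = f - R m" for m
      unfolding u_def R(3)[symmetric] by (rule sum_lessThan_telescope')
    have N_R: "N (R k) \<le> (1/2) ^ k" for k
    proof -
      have "N (R k) \<le> (1/2) ^ (n + k)"
        using R(2)[of k] s(3)[of "n + k"] by simp
      also have "\<dots> \<le> (1/2) ^ k"
        by (rule power_decreasing) auto
      finally show ?thesis .
    qed
    have "N (u k) \<le> 2 * (1/2) ^ k" for k
      using N_diff[OF R(1) R(1), of k "Suc k"] N_R[of k] N_R[of "Suc k"]
        zero_le_power[of "1/2 :: real" k]
      unfolding u_def by (simp del: zero_le_power)
    then have summable: "summable (\<lambda>k. N (u k))"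
      by (intro summable_comparison_test'[OF summable_mult[OF summable_geometric[of "1/2 :: real"]],
            of 0 _ 2]) (auto simp: N_nonneg)
    have tail: "q (R m - R m') \<le> 2 * (1/2) ^ (n + m)" if "m \<le> m'" for m m'
    proof -
      \<comment> \<open>The subtracted term strengthens the claim so that the induction closes: each
        step costs at most (1/2)^(n+j), half of 2 * (1/2)^(n+j).\<close>
      have "q (R m - R m') \<le> 2 * (1/2) ^ (n + m) - 2 * (1/2) ^ (n + m')"
        using that
      proof (induction m' rule: dec_induct)
        case base
        then show ?case
          by (simp add: q_def)
      next
        case (step j)
        then show ?case
          using q_triangle[of "R m" "R (Suc j)" "R j"] qR[of j] by simp
      qed
      then show ?thesis
        using zero_le_power[of "1/2 :: real" "n + m'"] by (simp del: zero_le_power)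
    qed
    have "metr.MCauchy (\<lambda>m. f - R m)"
      unfolding metr.MCauchy_def
    proof (intro conjI allI impI)
      fix \<epsilon> :: real assume "\<epsilon> > 0"
      have "(\<lambda>m. 2 * (1/2 :: real) ^ m) \<longlonglongrightarrow> 2 * 0"
        by (intro tendsto_intros LIMSEQ_power_zero) simp
      then have "\<forall>\<^sub>F m in sequentially. 2 * (1/2) ^ m < \<epsilon>"
        by (rule order_tendstoD) (simp add: \<open>\<epsilon> > 0\<close>)
      then obtain K where K: "2 * (1/2) ^ K < \<epsilon>"
        by (auto simp: eventually_sequentially)
      have "d (f - R m) (f - R m') < \<epsilon>" if "K \<le> m" "m \<le> m'" for m m'
      proof -
        have "d (f - R m) (f - R m') = q (R m - R m')"
          using metr.commute[of "f - R m" "f - R m'"] by (simp add: d_eq)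
        also have "\<dots> \<le> 2 * (1/2) ^ (n + m)"
          by (rule tail) fact
        also have "\<dots> \<le> 2 * (1/2) ^ K"
          using that by (intro mult_left_mono power_decreasing) auto
        finally show ?thesis
          using K by simp
      qed
      then show "\<exists>K. \<forall>m m'. K \<le> m \<longrightarrow> K \<le> m' \<longrightarrow> d (f - R m) (f - R m') < \<epsilon>"
        by (metis metr.commute nle_le)
    qed simp
    then obtain g where "limitin metr.mtopology (\<lambda>m. f - R m) g sequentially"
      using d_complete by (auto simp: metr.mcomplete_def)
    then have lim: "(\<lambda>m. f - R m) \<longlonglongrightarrow> g"
      by (simp add: d_top)
    have "(\<lambda>m. N (R m)) \<longlonglongrightarrow> 0"
    proof (rule tendsto_sandwich[OF _ _ tendsto_const])
      show "(\<lambda>m. (1/2 :: real) ^ m) \<longlonglongrightarrow> 0"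
        by (rule LIMSEQ_power_zero) simp
    qed (auto simp: N_nonneg N_R)
    then have "f = g"
      using lim closed[OF u summable f(1), of g] unfolding sum_u by simp
    have "q g \<le> 2 * (1/2) ^ n + q (f - R m - g)" for m
      using q_diff[of "f - R m" "f - R m - g"] tail[of 0 m] by (simp add: R(3))
    moreover have "(\<lambda>m. 2 * (1/2) ^ n + q (f - R m - g)) \<longlonglongrightarrow> 2 * (1/2) ^ n + 0"
      using lim unfolding tendsto_q by (intro tendsto_intros)
    ultimately have "q g \<le> 2 * (1/2) ^ n + 0"
      by (intro LIMSEQ_le_const) auto
    then show ?thesis
      by (simp add: \<open>f = g\<close>)
  qed
  have "open (p -` {..<1})"
    using p(2) by (intro open_vimage) auto
  then have "openin metr.mtopology (p -` {..<1})"
    by (simp add: d_top)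
  moreover have "0 \<in> p -` {..<1}"
    using seminorm_zero[OF vector_space_axioms p(1)] by simp
  ultimately obtain \<delta> where \<delta>: "\<delta> > 0" "metr.mball 0 \<delta> \<subseteq> p -` {..<1}"
    unfolding metr.openin_mtopology by blast
  \<comment> \<open>The factor 1/2 absorbs the 2 in \<open>small\<close>.\<close>
  obtain n where n: "(1/2) ^ n < \<delta> / 2"
    using \<delta>(1) real_arch_pow_inv[of "\<delta> / 2" "1/2"] by auto
  have p_le_1: "p f \<le> 1" if "f \<in> E" "N f < s n" for f
  proof -
    have "f \<in> metr.mball 0 \<delta>"
      using small[OF that] n metr.commute[of 0 f] by (simp add: q_def)
    then show ?thesis
      using \<delta>(2) by auto
  qed
  show ?thesis
  proof (intro exI[of _ "2 / s n"] conjI ballI)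
    show "2 / s n > 0"
      using s(1) by simp
    fix f assume f: "f \<in> E"
    show "p f \<le> 2 / s n * N f"
    proof (cases "N f = 0")
      case True
      then show ?thesis
        using N_eq_0[OF f] seminorm_zero[OF vector_space_axioms p(1)] by simp
    next
      case False
      \<comment> \<open>\<open>t\<close> rescales \<open>f\<close> to norm \<open>s n / 2\<close>,
        strictly below the threshold; this gives the constant \<open>2 / s n\<close>.\<close>
      define t where "t = s n / (2 * N f)"
      have t: "t > 0"
        using False N_nonneg[of f] s(1)[of n] by (simp add: t_def)
      have "N (smul (of_real t) f) = t * N f"
        using t by (simp add: N_scale)
      also have "\<dots> < s n"
        using False s(1)[of n] by (simp add: t_def)
      finally have "N (smul (of_real t) f) < s n" .
      then have "p (smul (of_real t) f) \<le> 1"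
        by (intro p_le_1 subspace_scale[OF subspace_E] f)
      then have "t * p f \<le> 1"
        using p(1) t by (simp add: seminorm_def)
      then have "p f \<le> 1 / t"
        using t by (simp add: field_simps)
      then show ?thesis
        by (simp add: t_def)
    qed
  qed
qed

subsection \<open>The norm induced by a total Riesz-Fischer map\<close>

lemma bracket_linear:
  assumes "F \<in> conjugate_dual smul"
  shows "bracket (f + g) F = bracket f F + bracket g F"
    and "bracket (smul c f) F = c * bracket f F"
    and "continuous_on UNIV (\<lambda>f. bracket f F)"
  using assms by (auto simp: conjugate_dual_def bracket_def intro: continuous_on_cnj)

context
  fixes smul :: "complex \<Rightarrow> 'd::topological_ab_group_add \<Rightarrow> 'd"
    and M :: "'x measure"
    and \<omega> :: "'x \<Rightarrow> 'd \<Rightarrow> complex"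
    and B E N
  defines "B f \<equiv> \<lambda>x. bracket f (\<omega> x)"
    and "E \<equiv> {f. B f \<in> L2 M}"
    and "N f \<equiv> L2_norm M (B f)"
  assumes smul: "vector_space smul"
    and total: "total_map smul M \<omega>"
    and RF: "riesz_fischer_map smul M \<omega>"
begin

interpretation vector_space smul
  by (rule smul)

text \<open>The values of \<open>\<omega>\<close> are constrained only on \<open>space M\<close>, so
  the pointwise rules are restricted to it. The last claim is totality.\<close>

lemma bracket_map:
  shows B_measurable[measurable]: "B f \<in> borel_measurable M"
    and B_add: "x \<in> space M \<Longrightarrow> B (f + g) x = B f x + B g x"
    and B_scale: "x \<in> space M \<Longrightarrow> B (smul c f) x = c * B f x"
    and B_continuous: "x \<in> space M \<Longrightarrow> continuous_on UNIV (\<lambda>f. B f x)"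
    and B_eq_0: "AE x in M. B f x = 0 \<Longrightarrow> f = 0"
proof -
  have \<omega>: "\<omega> x \<in> conjugate_dual smul" if "x \<in> space M" for x
    using total that by (auto simp: total_map_def weakly_measurable_map_def)
  show "B f \<in> borel_measurable M" "AE x in M. B f x = 0 \<Longrightarrow> f = 0"
    using total by (auto simp: total_map_def weakly_measurable_map_def B_def)
  show "B (f + g) x = B f x + B g x" "B (smul c f) x = c * B f x"
    "continuous_on UNIV (\<lambda>f. B f x)" if "x \<in> space M"
    unfolding B_def by (fact bracket_linear[OF \<omega>[OF that]])+
qed

lemma B_diff: "x \<in> space M \<Longrightarrow> B (f - g) x = B f x - B g x"
  using B_add[of x "f - g" g] by simp

lemma B_zero: "x \<in> space M \<Longrightarrow> B 0 x = 0"
  using B_diff[of x 0 0] by simp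

lemma B_sum: "x \<in> space M \<Longrightarrow> B (\<Sum>k\<in>I. u k) x = (\<Sum>k\<in>I. B (u k) x)"
  by (induction I rule: infinite_finite_induct) (simp_all add: B_zero B_add)

lemma N_diff_sum: "N (f - (\<Sum>k<n. u k)) = L2_norm M (\<lambda>x. B f x - (\<Sum>k<n. B (u k) x))"
  unfolding N_def by (intro L2_norm_cong_AE) (auto simp: B_diff B_sum)

lemma E_add: "f \<in> E \<Longrightarrow> g \<in> E \<Longrightarrow> f + g \<in> E"
  unfolding E_def mem_Collect_eq by (erule (1) L2_cong_AE[OF L2_add]) (auto simp: B_add)

lemma E_scale: "f \<in> E \<Longrightarrow> smul c f \<in> E"
  unfolding E_def mem_Collect_eq by (erule L2_cong_AE[OF L2_scale]) (auto simp: B_scale)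

text \<open>\<open>L2_series\<close> yields a limit in \<open>L2 M\<close>, and the Riesz-Fischer
  property realises it as \<open>B f\<close>. The almost everywhere convergence is kept for the
  closed graph.\<close>

lemma bracket_series:
  assumes u: "\<And>k. u k \<in> E" and sum: "summable (\<lambda>k. N (u k))"
  obtains f where "f \<in> E" and "(\<lambda>n. N (f - (\<Sum>k<n. u k))) \<longlonglongrightarrow> 0"
    and "AE x in M. (\<lambda>n. \<Sum>k<n. B (u k) x) \<longlonglongrightarrow> B f x"
proof -
  obtain h where h: "h \<in> L2 M" "AE x in M. (\<lambda>n. \<Sum>k<n. B (u k) x) \<longlonglongrightarrow> h x"
      "(\<lambda>n. L2_norm M (\<lambda>x. h x - (\<Sum>k<n. B (u k) x))) \<longlonglongrightarrow> 0"
    using L2_series[of "\<lambda>k. B (u k)" M] u sum by (auto simp: E_def N_def)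
  have [measurable]: "h \<in> borel_measurable M"
    using h(1) by (simp add: L2_def)
  obtain f where "is_solution M \<omega> h f"
    using RF h(1) by (auto simp: riesz_fischer_map_def)
  then have f: "AE x in M. B f x = h x"
    by (simp add: is_solution_def B_def)
  show thesis
  proof
    show "f \<in> E"
      using L2_cong_AE[OF h(1) _ f] by (simp add: E_def)
    have "N (f - (\<Sum>k<n. u k)) = L2_norm M (\<lambda>x. h x - (\<Sum>k<n. B (u k) x))" for n
      unfolding N_diff_sum by (intro L2_norm_cong_AE) (use f in auto)
    then show "(\<lambda>n. N (f - (\<Sum>k<n. u k))) \<longlonglongrightarrow> 0"
      using h(3) by simp
    show "AE x in M. (\<lambda>n. \<Sum>k<n. B (u k) x) \<longlonglongrightarrow> B f x"
      using h(2) f by eventually_elim simp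
  qed
qed

lemma complete_norm_on_bracket: "complete_norm_on smul E N"
proof
  show "subspace E"
    by (rule subspaceI) (use E_add E_scale E_scale[of _ 0] L2_cong_AE[OF L2_zero, of "B 0"]
        in \<open>auto simp: E_def B_zero\<close>)
  show "0 \<le> N f" for f
    by (simp add: N_def L2_norm_nonneg)
  show "N (smul c f) = cmod c * N f" for c f
    unfolding N_def L2_norm_scale[symmetric] by (intro L2_norm_cong_AE) (auto simp: B_scale)
  show "N (f + g) \<le> N f + N g" if "f \<in> E" "g \<in> E" for f g
  proof -
    have "N (f + g) = L2_norm M (\<lambda>x. B f x + B g x)"
      unfolding N_def by (intro L2_norm_cong_AE) (auto simp: B_add)
    then show ?thesis
      using L2_norm_triangle[of "B f" M "B g"] that by (simp add: E_def N_def)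
  qed
  show "f = 0" if "f \<in> E" "N f = 0" for f
    using that L2_norm_eq_0[of "B f" M] B_eq_0 by (simp add: E_def N_def)
  show "\<exists>f\<in>E. (\<lambda>n. N (f - (\<Sum>k<n. u k))) \<longlonglongrightarrow> 0"
    if "\<And>k. u k \<in> E" "summable (\<lambda>k. N (u k))" for u
    using bracket_series[OF that] by blast
qed

text \<open>Let \<open>h\<close> be the limit from \<open>bracket_series\<close>. Almost everywhere,
  the brackets of the partial sums tend to \<open>B h\<close> and, by continuity of \<omega>, also
  to \<open>B g\<close>; totality gives \<open>h = g\<close>. Uniqueness of limits for
  \<open>N\<close> gives \<open>f = h\<close>.\<close>

lemma bracket_closed:
  assumes u: "\<And>k. u k \<in> E" and sum: "summable (\<lambda>k. N (u k))" and f: "f \<in> E"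
    and lim: "(\<lambda>n. N (f - (\<Sum>k<n. u k))) \<longlonglongrightarrow> 0" "(\<lambda>n. \<Sum>k<n. u k) \<longlonglongrightarrow> g"
  shows "f = g"
proof -
  interpret complete_norm_on smul E N
    by (rule complete_norm_on_bracket)
  obtain h where h: "h \<in> E" "(\<lambda>n. N (h - (\<Sum>k<n. u k))) \<longlonglongrightarrow> 0"
      "AE x in M. (\<lambda>n. \<Sum>k<n. B (u k) x) \<longlonglongrightarrow> B h x"
    using bracket_series[OF u sum] by blast
  have "limitin norm.mtopology (\<lambda>n. \<Sum>k<n. u k) f' sequentially"
    if "f' \<in> E" "(\<lambda>n. N (f' - (\<Sum>k<n. u k))) \<longlonglongrightarrow> 0" for f'
    using that subspace_sum[OF subspace_E, of _ u] u
    by (simp add: norm.limitin_metric_dist_null N_minus_commute)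
  then have "f = h"
    using norm.limitin_metric_unique[OF _ _ trivial_limit_sequentially] f h lim by blast
  have "AE x in M. B (h - g) x = 0"
    using h(3) AE_space
  proof eventually_elim
    case (elim x)
    have "(\<lambda>n. B (\<Sum>k<n. u k) x) \<longlonglongrightarrow> B g x"
      by (rule continuous_on_tendsto_compose[OF B_continuous[OF elim(2)] lim(2)]) auto
    then have "B g x = B h x"
      using elim by (simp add: B_sum LIMSEQ_unique)
    then show ?case
      using elim by (simp add: B_diff)
  qed
  then show ?thesis
    using B_eq_0[of "h - g"] \<open>f = h\<close> by simp
qed

lemma solution_in_E:
  assumes "h \<in> L2 M" "is_solution M \<omega> h f"
  shows "f \<in> E"
proof -
  have "AE x in M. B f x = h x"
    using assms(2) by (simp add: is_solution_def B_def)
  then show ?thesis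
    unfolding E_def mem_Collect_eq by (rule L2_cong_AE[OF assms(1) B_measurable])
qed

end

theorem corollary3p7:
  fixes smul :: "complex \<Rightarrow> 'd::topological_ab_group_add \<Rightarrow> 'd"
    and M :: "'x measure"
    and \<omega> :: "'x \<Rightarrow> 'd \<Rightarrow> complex"
  assumes "frechet_space smul"
    and "sigma_finite_measure M"
    and "total_map smul M \<omega>"
    and "riesz_fischer_map smul M \<omega>"
  shows "\<forall>p. seminorm smul p \<and> continuous_on UNIV p \<longrightarrow>
    (\<exists>C>0. \<forall>h\<in>L2 M. \<forall>f. is_solution M \<omega> h f \<longrightarrow>
       p f \<le> C * L2_norm M (\<lambda>x. bracket f (\<omega> x)))"
proof (intro allI impI)
  fix p assume p: "seminorm smul p \<and> continuous_on UNIV p"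
  have smul: "vector_space smul"
    using assms(1) by (simp add: frechet_space_def locally_convex_space_def)
  note facts = smul assms(3,4)
  let ?E = "{f. (\<lambda>x. bracket f (\<omega> x)) \<in> L2 M}"
  let ?N = "\<lambda>f. L2_norm M (\<lambda>x. bracket f (\<omega> x))"
  \<comment> \<open>\<open>?E\<close> contains all solutions for right-hand sides in
    \<open>L2 M\<close>, so one constant on \<open>?E\<close> serves for every
    \<open>h\<close>.\<close>
  have "\<exists>C>0. \<forall>f\<in>?E. p f \<le> C * ?N f"
    using assms(1) complete_norm_on_bracket[OF facts] bracket_closed[OF facts] p
    by (intro closed_graph_seminorm_bound) blast+
  then show "\<exists>C>0. \<forall>h\<in>L2 M. \<forall>f. is_solution M \<omega> h f \<longrightarrow> p f \<le> C * ?N f"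
    using solution_in_E[OF facts] by blast
qed

end
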